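(* Let $n\ge1$, and consider all $2^{2n}\times(2n+2)$ two-level designs generated by $G=(v,I_n)$ as $v$ ranges over $Z_4^n$. For such $v$ and $i=0,1,2,3$, let $f_i$ be the number of entries of $v$ equal to $i$. Among all these designs, a design $D$ defined by a vector $v$ with $f_1+f_3=n-1$ and $f_2=1$ has maximum projectivity $2n-1$, and so does a design $D$ defined by a vector $v$ with $f_1+f_3=n$ and $f_2=0$.
   Context: $Z_4=\{0,1,2,3\}$ is the ring of integers modulo 4. Design generated by $G=(v,I_n)$: let $C$ be the $2^{2n}\times(n+1)$ matrix whose rows are all linear combinations $uG$, $u\in Z_4^n$. Replace each entry of $C$ by a pair of $\pm1$ symbols via the Gray map $0\mapsto(1,1)$, $1\mapsto(1,-1)$, $2\mapsto(-1,-1)$, $3\mapsto(-1,1)$, so that column $j$ of $C$ becomes columns $2j-1,2j$. The result $D$ is a $2^{2n}\times(2n+2)$ matrix with entries $\pm1$ (a two-level design; rows are runs, columns are factors). A two-level design has projectivity $p$ if for every set of $p$ columns, the projection of the design onto these columns contains all $2^p$ level combinations in $\{\pm1\}^p$ (possibly with repetitions). "The projectivity" of a design is the largest such $p$ (it is $0$ if some column is constant). "$D$ has maximum projectivity $x$ among a class" means the projectivity of $D$ is $x$ and no design in the class has projectivity larger than $x$. *)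

theory Defs
  imports "Jordan_Normal_Form.Matrix" "HOL-Library.Numeral_Type" "HOL-Library.FuncSet"
begin

text \<open>
  The ring \<open>Z\<^sub>4\<close> is the numeral type \<open>4\<close>, whose arithmetic is arithmetic modulo 4.
  All row and column indices are counted from 0.
\<close>

definition generator_matrix :: "4 vec \<Rightarrow> 4 mat" where
  "generator_matrix v = mat_of_cols (dim_vec v) (v # cols (1\<^sub>m (dim_vec v)))"

text \<open>
  Row \<open>i\<close> consists of the \<open>n\<close> base-4 digits of \<open>i\<close>, least significant digit first
  (\<open>of_nat\<close> reduces modulo 4). The order in which the vectors of \<open>Z\<^sub>4\<^sup>n\<close> are listed is a
  convention; \<open>bij_betw_row_all_vectors_matrix\<close> below shows that each of them is listed
  exactly once.
\<close>
definition all_vectors_matrix :: "nat \<Rightarrow> 4 mat" where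
  "all_vectors_matrix n = mat (4 ^ n) n (\<lambda>(i, j). of_nat (i div 4 ^ j))"

definition linear_combinations_matrix :: "4 mat \<Rightarrow> 4 mat" where
  "linear_combinations_matrix G = all_vectors_matrix (dim_row G) * G"

definition gray :: "4 \<Rightarrow> int \<times> int" where
  "gray x = (if x = 0 then (1, 1) else if x = 1 then (1, -1)
             else if x = 2 then (-1, -1) else (-1, 1))"

definition gray_matrix :: "4 mat \<Rightarrow> int mat" where
  "gray_matrix C = mat (dim_row C) (2 * dim_col C)
     (\<lambda>(i, j). (if even j then fst else snd) (gray (C $$ (i, j div 2))))"

definition generated_design :: "4 vec \<Rightarrow> int mat" where
  "generated_design v = gray_matrix (linear_combinations_matrix (generator_matrix v))"

text \<open>
  The bound \<open>p \<le> dim_col D\<close> excludes values of \<open>p\<close> for which there is no set of \<open>p\<close> columns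
  and the remaining condition would hold vacuously.
\<close>
definition has_projectivity :: "int mat \<Rightarrow> nat \<Rightarrow> bool" where
  "has_projectivity D p \<longleftrightarrow> p \<le> dim_col D \<and>
     (\<forall>J. J \<subseteq> {..<dim_col D} \<and> card J = p \<longrightarrow>
        (\<forall>s \<in> J \<rightarrow> {1, -1}. \<exists>i<dim_row D. \<forall>j\<in>J. D $$ (i, j) = s j))"

definition projectivity :: "int mat \<Rightarrow> nat" where
  "projectivity D = Max {p. has_projectivity D p}"

definition has_maximum_projectivity_among :: "int mat \<Rightarrow> nat \<Rightarrow> int mat set \<Rightarrow> bool" where
  "has_maximum_projectivity_among D x \<D> \<longleftrightarrow>
     D \<in> \<D> \<and> projectivity D = x \<and> (\<forall>D'\<in>\<D>. projectivity D' \<le> x)"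

definition entry_count :: "4 \<Rightarrow> 4 vec \<Rightarrow> nat" where
  "entry_count a v = card {j. j < dim_vec v \<and> v $ j = a}"

lemma Z4_of_nat_inj:
  assumes "(of_nat a :: 4) = of_nat b" "a < 4" "b < 4"
  shows "a = b"
proof -
  have "a \<in> {0, 1, 2, 3}" "b \<in> {0, 1, 2, 3}"
    using assms by auto
  then show ?thesis
    using assms(1) by auto
qed

lemma Z4_of_nat_mod: "(of_nat (a mod 4) :: 4) = of_nat a"
proof -
  have "(of_nat a :: 4) = of_nat (4 * (a div 4) + a mod 4)"
    by simp
  also have "\<dots> = 4 * of_nat (a div 4) + of_nat (a mod 4)"
    by (simp only: of_nat_add of_nat_mult of_nat_numeral)
  also have "(4 :: 4) = 0"
    by simp
  also have "0 * of_nat (a div 4) + of_nat (a mod 4) = (of_nat (a mod 4) :: 4)"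
    by simp
  finally show ?thesis ..
qed

lemma Z4_of_nat_eq_iff: "(of_nat a :: 4) = of_nat b \<longleftrightarrow> a mod 4 = b mod 4"
  using Z4_of_nat_inj[of "a mod 4" "b mod 4"] Z4_of_nat_mod[of a] Z4_of_nat_mod[of b]
  by auto

lemma Z4_obtain_digit: obtains d where "d < 4" "(x :: 4) = of_nat d"
proof -
  have "inj_on (of_nat :: nat \<Rightarrow> 4) {..<4}"
    by (auto intro!: inj_onI Z4_of_nat_inj)
  then have "card ((of_nat :: nat \<Rightarrow> 4) ` {..<4}) = CARD(4)"
    by (simp add: card_image)
  then have "(of_nat :: nat \<Rightarrow> 4) ` {..<4} = UNIV"
    by (intro card_subset_eq) auto
  then show ?thesis
    using that by blast
qed

lemma row_all_vectors_matrix: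
  "i < 4 ^ n \<Longrightarrow> row (all_vectors_matrix n) i = vec n (\<lambda>j. of_nat (i div 4 ^ j))"
  by (auto simp: all_vectors_matrix_def)

lemma digits_inj:
  "a < 4 ^ n \<Longrightarrow> b < 4 ^ n \<Longrightarrow> (\<And>j. j < n \<Longrightarrow> (a div 4 ^ j) mod 4 = (b div 4 ^ j) mod 4)
     \<Longrightarrow> a = (b :: nat)"
proof (induction n arbitrary: a b)
  case (Suc n)
  have "a div 4 = b div 4"
  proof (rule Suc.IH)
    show "a div 4 < 4 ^ n" "b div 4 < 4 ^ n"
      using Suc.prems(1,2) by auto
    show "(a div 4 div 4 ^ j) mod 4 = (b div 4 div 4 ^ j) mod 4" if "j < n" for j
      using Suc.prems(3)[of "Suc j"] that by (simp add: div_mult2_eq)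
  qed
  moreover have "a mod 4 = b mod 4"
    using Suc.prems(3)[of 0] by simp
  ultimately show ?case
    by (metis div_mult_mod_eq)
qed simp

lemma digits_surj: "\<exists>a < 4 ^ n. \<forall>j<n. (of_nat (a div 4 ^ j) :: 4) = u j"
proof (induction n arbitrary: u)
  case (Suc n)
  obtain a where a: "a < 4 ^ n" "\<forall>j<n. (of_nat (a div 4 ^ j) :: 4) = u (Suc j)"
    using Suc.IH[of "\<lambda>j. u (Suc j)"] by blast
  obtain d where d: "d < 4" "u 0 = of_nat d"
    by (rule Z4_obtain_digit)
  have "(of_nat ((4 * a + d) div 4 ^ j) :: 4) = u j" if "j < Suc n" for j
  proof (cases j)
    case 0
    then show ?thesis
      using d Z4_of_nat_eq_iff[of "4 * a + d" d] by simp
  next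
    case (Suc k)
    have "(4 * a + d) div 4 = a"
      using d by simp
    then show ?thesis
      using Suc a that by (simp add: div_mult2_eq)
  qed
  moreover have "4 * a + d < 4 ^ Suc n"
    using a d by simp
  ultimately show ?case
    by blast
qed simp

lemma bij_betw_row_all_vectors_matrix:
  "bij_betw (row (all_vectors_matrix n)) {..<4 ^ n} (carrier_vec n)"
proof (rule bij_betw_imageI)
  show "inj_on (row (all_vectors_matrix n)) {..<4 ^ n}"
  proof (rule inj_onI)
    fix a b :: nat
    assume ab: "a \<in> {..<4 ^ n}" "b \<in> {..<4 ^ n}"
      "row (all_vectors_matrix n) a = row (all_vectors_matrix n) b"
    show "a = b"
    proof (rule digits_inj)
      show "a < 4 ^ n" "b < 4 ^ n"
        using ab by auto
      show "(a div 4 ^ j) mod 4 = (b div 4 ^ j) mod 4" if "j < n" for j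
        using arg_cong[OF ab(3), of "\<lambda>w. w $ j"] ab(1,2) that
        by (simp add: row_all_vectors_matrix Z4_of_nat_eq_iff)
    qed
  qed
  show "row (all_vectors_matrix n) ` {..<4 ^ n} = carrier_vec n"
  proof
    show "row (all_vectors_matrix n) ` {..<4 ^ n} \<subseteq> carrier_vec n"
      by (auto simp: row_all_vectors_matrix)
    show "carrier_vec n \<subseteq> row (all_vectors_matrix n) ` {..<4 ^ n}"
    proof
      fix u :: "4 vec"
      assume u: "u \<in> carrier_vec n"
      obtain a where a: "a < 4 ^ n" "\<forall>j<n. (of_nat (a div 4 ^ j) :: 4) = u $ j"
        using digits_surj[of n "\<lambda>j. u $ j"] by blast
      have "row (all_vectors_matrix n) a = u"
        using a u by (auto simp: row_all_vectors_matrix)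
      then show "u \<in> row (all_vectors_matrix n) ` {..<4 ^ n}"
        using a(1) by blast
    qed
  qed
qed

lemma generated_design_carrier:
  assumes "v \<in> carrier_vec n"
  shows "generated_design v \<in> carrier_mat (2 ^ (2 * n)) (2 * n + 2)"
  using assms
  by (auto simp: generated_design_def gray_matrix_def linear_combinations_matrix_def
      all_vectors_matrix_def generator_matrix_def power_mult)

end

theory Submission
  imports Defs
begin

text \<open>
  A run is a tuple \<open>y\<^sub>0, \<dots>, y\<^sub>n\<close> in \<open>Z\<^sub>4\<close> with \<open>y\<^sub>0 = \<Sum>\<^sub>j v\<^sub>j y\<^sub>j\<^sub>+\<^sub>1\<close>, that is, with
  \<open>\<Sum>\<^sub>b w\<^sub>b y\<^sub>b = 0\<close> where \<open>w\<^sub>0 = -1\<close> and \<open>w\<^sub>j\<^sub>+\<^sub>1 = v\<^sub>j\<close>. Prescribe levels on \<open>2n - 1\<close> of the \<open>2n + 2\<close> columns.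
  If \<open>m\<^sub>b\<close> of the two columns of block \<open>b\<close> are left free and \<open>w\<^sub>b\<close> is odd, the values of
  \<open>w\<^sub>b y\<^sub>b\<close> compatible with the prescription contain an arithmetic progression of step 1 and
  length \<open>m\<^sub>b + 1\<close>; if \<open>w\<^sub>b = 2\<close>, they contain one of step 2 and the same length. Since
  \<open>\<Sum>\<^sub>b m\<^sub>b = 3\<close> and at most one step is 2, the sums of these progressions cover \<open>Z\<^sub>4\<close>, so \<open>0\<close> is attained.

  Conversely, no design has projectivity \<open>2n\<close>: requiring level \<open>1\<close> in all columns of the
  blocks \<open>2, \<dots>, n\<close> leaves \<open>y\<^sub>0 = v\<^sub>0 y\<^sub>1\<close>, and for each of the four values of \<open>v\<^sub>0\<close> two of the columns
  of the blocks 0 and 1 then fail to show one of the four level combinations.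
\<close>

section \<open>Exhaustion over the ring of integers modulo 4\<close>

lemma Z4_ex_iff: "(\<exists>x :: 4. P x) \<longleftrightarrow> P 0 \<or> P 1 \<or> P 2 \<or> P 3"
proof -
  have "x \<in> {0, 1, 2, 3}" for x :: 4
  proof -
    obtain d where "d < 4" "x = of_nat d"
      by (rule Z4_obtain_digit)
    moreover from \<open>d < 4\<close> have "d \<in> {0, 1, 2, 3}"
      by auto
    ultimately show ?thesis
      by auto
  qed
  then show ?thesis
    by (metis empty_iff insert_iff)
qed

lemma Z4_cases:
  obtains "(x :: 4) = 0" | "x = 1" | "x = 2" | "x = 3"
  using Z4_ex_iff[of "\<lambda>y. y = x"] by auto

section \<open>Runs of a generated design\<close>

text \<open>Only the parity of \<open>c\<close> matters, so a column index is passed as it stands;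
  column \<open>c\<close> belongs to block \<open>c div 2\<close>.\<close>

definition gray_coord :: "nat \<Rightarrow> 4 \<Rightarrow> int" where
  "gray_coord c x = (if even c then fst else snd) (gray x)"

text \<open>Membership in the row space of \<open>(v, I)\<close>: the identity block makes the
  coefficients of a combination its entries after the first.\<close>

definition codeword :: "4 vec \<Rightarrow> (nat \<Rightarrow> 4) \<Rightarrow> bool" where
  "codeword v y \<longleftrightarrow> y 0 = (\<Sum>j<dim_vec v. v $ j * y (Suc j))"

lemma generated_design_entry:
  assumes "v \<in> carrier_vec n" "i < 4 ^ n" "c < 2 * n + 2"
  shows "generated_design v $$ (i, c) = gray_coord c
    (case c div 2 of 0 \<Rightarrow> \<Sum>j<n. v $ j * of_nat (i div 4 ^ j) | Suc j \<Rightarrow> of_nat (i div 4 ^ j))"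
proof -
  let ?G = "generator_matrix v"
  have dim: "dim_vec v = n" "dim_row ?G = n" "dim_col ?G = Suc n"
    using assms(1) by (auto simp: generator_matrix_def)
  have b: "c div 2 < Suc n"
    using assms(3) by auto
  have col: "col ?G (c div 2) = (case c div 2 of 0 \<Rightarrow> v | Suc j \<Rightarrow> unit_vec n j)"
    using b dim(1) assms(1)
    by (auto simp: generator_matrix_def nth_Cons' split: nat.split)
  have "generated_design v $$ (i, c)
      = gray_coord c (row (all_vectors_matrix n) i \<bullet> col ?G (c div 2))"
    using assms b dim by (auto simp: generated_design_def gray_matrix_def gray_coord_def
        linear_combinations_matrix_def all_vectors_matrix_def)
  also have "row (all_vectors_matrix n) i \<bullet> col ?G (c div 2) =
    (case c div 2 of 0 \<Rightarrow> \<Sum>j<n. v $ j * of_nat (i div 4 ^ j) | Suc j \<Rightarrow> of_nat (i div 4 ^ j))"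
    unfolding col row_all_vectors_matrix[OF assms(2)] using b dim(1)
    by (auto simp: scalar_prod_def atLeast0LessThan mult.commute if_distrib[of "\<lambda>x. x * _"]
        split: nat.split intro!: sum.cong cong: if_cong)
  finally show ?thesis .
qed

lemma ex_run_iff_codeword:
  assumes v: "v \<in> carrier_vec n" and J: "J \<subseteq> {..<2 * n + 2}"
  shows "(\<exists>i<dim_row (generated_design v). \<forall>c\<in>J. generated_design v $$ (i, c) = s c) \<longleftrightarrow>
    (\<exists>y. codeword v y \<and> (\<forall>c\<in>J. gray_coord c (y (c div 2)) = s c))"
proof -
  have rows: "dim_row (generated_design v) = 4 ^ n"
    using generated_design_carrier[OF v] by (simp add: power_mult)
  have dim: "dim_vec v = n"
    using v by simp
  show ?thesis
  proof
    assume "\<exists>i<dim_row (generated_design v). \<forall>c\<in>J. generated_design v $$ (i, c) = s c"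
    then obtain i where i: "i < 4 ^ n" "\<forall>c\<in>J. generated_design v $$ (i, c) = s c"
      using rows by auto
    define y :: "nat \<Rightarrow> 4" where "y b = (case b of 0 \<Rightarrow> \<Sum>j<n. v $ j * of_nat (i div 4 ^ j)
      | Suc j \<Rightarrow> of_nat (i div 4 ^ j))" for b
    have "codeword v y"
      by (simp add: codeword_def y_def dim)
    moreover have "gray_coord c (y (c div 2)) = s c" if "c \<in> J" for c
      using generated_design_entry[OF v i(1), of c] i(2) that J by (auto simp: y_def)
    ultimately show "\<exists>y. codeword v y \<and> (\<forall>c\<in>J. gray_coord c (y (c div 2)) = s c)"
      by blast
  next
    assume "\<exists>y. codeword v y \<and> (\<forall>c\<in>J. gray_coord c (y (c div 2)) = s c)"
    then obtain y where y: "codeword v y" "\<forall>c\<in>J. gray_coord c (y (c div 2)) = s c"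
      by blast
    \<comment> \<open>The base-4 digits of the row index are chosen to be the coefficients; the
      entry in block 0 is then determined by \<open>codeword\<close>.\<close>
    obtain i where i: "i < 4 ^ n" "\<forall>j<n. (of_nat (i div 4 ^ j) :: 4) = y (Suc j)"
      using digits_surj[of n "\<lambda>j. y (Suc j)"] by blast
    have "generated_design v $$ (i, c) = s c" if "c \<in> J" for c
    proof -
      have c: "c < 2 * n + 2"
        using that J by auto
      have "(case c div 2 of 0 \<Rightarrow> \<Sum>j<n. v $ j * of_nat (i div 4 ^ j)
          | Suc j \<Rightarrow> of_nat (i div 4 ^ j)) = y (c div 2)"
      proof (cases "c div 2")
        case 0
        then show ?thesis
          using i(2) y(1) by (simp add: codeword_def dim)
      next
        case (Suc j)
        then have "j < n"
          using c by auto
        then show ?thesis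
          using i(2) Suc by simp
      qed
      then show ?thesis
        using generated_design_entry[OF v i(1) c] y(2) that by simp
    qed
    then show "\<exists>i<dim_row (generated_design v). \<forall>c\<in>J. generated_design v $$ (i, c) = s c"
      using i(1) rows by auto
  qed
qed

lemma has_projectivity_generated_design_iff:
  assumes "v \<in> carrier_vec n"
  shows "has_projectivity (generated_design v) p \<longleftrightarrow> p \<le> 2 * n + 2 \<and>
    (\<forall>J. J \<subseteq> {..<2 * n + 2} \<and> card J = p \<longrightarrow> (\<forall>s \<in> J \<rightarrow> {1, -1}.
      \<exists>y. codeword v y \<and> (\<forall>c\<in>J. gray_coord c (y (c div 2)) = s c)))"
proof -
  have "dim_col (generated_design v) = 2 * n + 2"
    using generated_design_carrier[OF assms] by simp
  then show ?thesis
    unfolding has_projectivity_def using ex_run_iff_codeword[OF assms] by auto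
qed

section \<open>Projectivity\<close>

lemma has_projectivity_antimono:
  assumes p: "has_projectivity D p" and "q \<le> p"
  shows "has_projectivity D q"
  unfolding has_projectivity_def
proof (intro conjI allI impI ballI)
  show "q \<le> dim_col D"
    using assms by (auto simp: has_projectivity_def)
  fix J s
  assume J: "J \<subseteq> {..<dim_col D} \<and> card J = q" and s: "s \<in> J \<rightarrow> {1, - 1 :: int}"
  obtain K where K: "J \<subseteq> K" "K \<subseteq> {..<dim_col D}" "card K = p"
    using J assms exists_subset_between[of J p "{..<dim_col D}"]
    by (auto simp: has_projectivity_def)
  \<comment> \<open>The added columns may carry any levels.\<close>
  define s' where "s' j = (if j \<in> J then s j else 1)" for j
  have "s' \<in> K \<rightarrow> {1, - 1}"
    using s by (auto simp: s'_def Pi_iff)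
  then obtain i where "i < dim_row D" "\<forall>j\<in>K. D $$ (i, j) = s' j"
    using p K unfolding has_projectivity_def by blast
  then show "\<exists>i<dim_row D. \<forall>j\<in>J. D $$ (i, j) = s j"
    using K(1) by (auto simp: s'_def intro!: exI[of _ i] dest: bspec)
qed

text \<open>Ensures that the set whose \<open>Max\<close> defines \<open>projectivity\<close> is
  nonempty.\<close>

lemma has_projectivity_0:
  assumes "0 < dim_row D"
  shows "has_projectivity D 0"
proof -
  have "J = {}" if "J \<subseteq> {..<dim_col D}" "card J = 0" for J
    using that finite_subset[OF that(1)] by simp
  then show ?thesis
    using assms unfolding has_projectivity_def by auto
qed

lemma finite_has_projectivity: "finite {p. has_projectivity D p}"
  by (rule finite_subset[of _ "{..dim_col D}"]) (auto simp: has_projectivity_def)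

text \<open>Failure at \<open>p\<close> excludes every larger value by
  \<open>has_projectivity_antimono\<close>.\<close>

lemma projectivity_less:
  assumes "0 < dim_row D" "\<not> has_projectivity D p"
  shows "projectivity D < p"
proof -
  have "q < p" if "has_projectivity D q" for q
    using has_projectivity_antimono[OF that, of p] assms(2) by force
  then show ?thesis
    unfolding projectivity_def using has_projectivity_0[OF assms(1)]
    by (subst Max_less_iff) (auto simp: finite_has_projectivity)
qed

lemma projectivity_ge: "has_projectivity D p \<Longrightarrow> p \<le> projectivity D"
  unfolding projectivity_def by (rule Max_ge) (auto simp: finite_has_projectivity)

section \<open>The upper bound\<close>

text \<open>Here \<open>x\<close> is the value of block 1 and \<open>w * x\<close> that of block 0.
  For \<open>w = 0\<close> column 1 is constantly 1; for \<open>w = 1\<close> columns 1 and 3 agree,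
  for \<open>w = 2\<close> columns 0 and 1, for \<open>w = 3\<close> columns 0 and 3. Each time the
  pair of levels (1, -1) is missing.\<close>

lemma gray_coords_not_independent:
  "\<exists>c d. c < 4 \<and> d < 4 \<and> c \<noteq> d \<and>
    (\<forall>x. gray_coord c (if c < 2 then w * x else x) = 1 \<longrightarrow>
         gray_coord d (if d < 2 then w * x else x) \<noteq> - 1)"
proof -
  have all: "(\<forall>x :: 4. P x) \<longleftrightarrow> P 0 \<and> P 1 \<and> P 2 \<and> P 3" for P
    using Z4_ex_iff[of "\<lambda>x. \<not> P x"] by auto
  show ?thesis
  proof (cases w rule: Z4_cases)
    case 1
    then show ?thesis
      by (intro exI[of _ 0] exI[of _ 1]) (simp add: all gray_coord_def gray_def)
  next
    case 2
    then show ?thesis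
      by (intro exI[of _ 1] exI[of _ 3]) (simp add: all gray_coord_def gray_def)
  next
    case 3
    then show ?thesis
      by (intro exI[of _ 0] exI[of _ 1]) (simp add: all gray_coord_def gray_def)
  next
    case 4
    then show ?thesis
      by (intro exI[of _ 0] exI[of _ 3]) (simp add: all gray_coord_def gray_def)
  qed
qed

lemma gray_coords_eq_1_imp_0:
  assumes "gray_coord (2 * b) x = 1" "gray_coord (2 * b + 1) x = 1"
  shows "x = 0"
  using assms by (cases x rule: Z4_cases) (auto simp: gray_coord_def gray_def)

lemma not_has_projectivity_generated_design:
  assumes n: "n \<ge> 1" and v: "v \<in> carrier_vec n"
  shows "\<not> has_projectivity (generated_design v) (2 * n)"
proof
  assume proj: "has_projectivity (generated_design v) (2 * n)"
  obtain c d :: nat where cd: "c < 4" "d < 4" "c \<noteq> d"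
    and dep: "\<And>x. gray_coord c (if c < 2 then v $ 0 * x else x) = 1 \<Longrightarrow>
      gray_coord d (if d < 2 then v $ 0 * x else x) \<noteq> - 1"
    using gray_coords_not_independent[of "v $ 0"] by blast
  define J where "J = insert c (insert d {4..<2 * n + 2})"
  define s where "s j = (if j = d then - 1 else 1 :: int)" for j
  have "J \<subseteq> {..<2 * n + 2}" "card J = 2 * n"
    using cd n by (auto simp: J_def)
  moreover have "s \<in> J \<rightarrow> {1, - 1}"
    by (auto simp: s_def)
  ultimately obtain y where y: "codeword v y" "\<forall>j\<in>J. gray_coord j (y (j div 2)) = s j"
    using proj unfolding has_projectivity_generated_design_iff[OF v] by blast
  \<comment> \<open>Both columns of these blocks lie in \<open>J\<close> and differ from
    \<open>d\<close>, so they have level 1; only the term \<open>j = 0\<close> of the sum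
    survives.\<close>
  have zero: "y (Suc j) = 0" if "j \<in> {..<n} - {0}" for j
  proof (rule gray_coords_eq_1_imp_0)
    show "gray_coord (2 * Suc j) (y (Suc j)) = 1"
      using bspec[OF y(2), of "2 * Suc j"] that cd by (auto simp: J_def s_def)
    have "(2 * Suc j + 1) div 2 = Suc j"
      by simp
    then show "gray_coord (2 * Suc j + 1) (y (Suc j)) = 1"
      using bspec[OF y(2), of "2 * Suc j + 1"] that cd by (auto simp: J_def s_def)
  qed
  have "y 0 = (\<Sum>j\<in>{..<n}. v $ j * y (Suc j))"
    using y(1) v by (simp add: codeword_def)
  also have "\<dots> = (\<Sum>j\<in>{0}. v $ j * y (Suc j))"
    using n zero by (intro sum.mono_neutral_right) auto
  finally have y0: "y 0 = v $ 0 * y 1"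
    by simp
  have block: "y (j div 2) = (if j < 2 then v $ 0 * y 1 else y 1)" if "j < 4" for j
  proof -
    have "j div 2 = (if j < 2 then 0 else 1)"
      using that by auto
    then show ?thesis
      using y0 by simp
  qed
  have "gray_coord c (y (c div 2)) = 1" "gray_coord d (y (d div 2)) = - 1"
    using y(2) cd by (auto simp: J_def s_def)
  then show False
    using dep[of "y 1"] block cd by simp
qed

section \<open>The lower bound\<close>

text \<open>One prescribed column leaves two cyclically adjacent values of \<open>x\<close>, two
  leave a single one. Multiplication by 1 or 3 keeps adjacency, multiplication by 2 turns it into
  distance 2. In a free block the three terms need not exhaust the values (\<open>w\<close> odd) or
  be distinct (\<open>w = 2\<close>).\<close>

lemma block_contains_progression:
  assumes w: "w \<noteq> 0" and s: "s (2 * b) \<in> {1, - 1}" "s (2 * b + 1) \<in> {1, - 1}"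
  shows "\<exists>a. \<forall>k \<le> of_bool (2 * b \<notin> J) + of_bool (2 * b + 1 \<notin> J). \<exists>x.
    (\<forall>c \<in> J \<inter> {2 * b, 2 * b + 1}. gray_coord c x = s c) \<and>
    w * x = a + (if w = 2 then 2 else 1) * of_nat k"
proof -
  have up_to: "(\<forall>k \<le> 0. P k) \<longleftrightarrow> P 0" "(\<forall>k \<le> Suc 0. P k) \<longleftrightarrow> P 0 \<and> P 1"
    "(\<forall>k \<le> Suc (Suc 0). P k) \<longleftrightarrow> P 0 \<and> P 1 \<and> P 2" for P :: "nat \<Rightarrow> bool"
    by (auto simp: le_Suc_eq numeral_2_eq_2)
  show ?thesis
    using s
    by (cases w rule: Z4_cases; cases "2 * b \<in> J"; cases "2 * b + 1 \<in> J")
      (auto simp: w up_to Z4_ex_iff gray_coord_def gray_def Int_insert_right)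
qed

text \<open>Adding progressions of step 1 with \<open>p + 1\<close> and \<open>q + 1\<close> terms
  gives one with \<open>p + q + 1\<close> terms. \<open>U b\<close> stands for compatibility with
  the levels prescribed in block \<open>b\<close>.\<close>

lemma odd_blocks_contain_progression:
  fixes w :: "nat \<Rightarrow> 4" and m :: "nat \<Rightarrow> nat"
  assumes "finite F"
    and "\<And>b. b \<in> F \<Longrightarrow> \<exists>a. \<forall>k\<le>m b. \<exists>x. U b x \<and> w b * x = a + of_nat k"
  shows "\<exists>a. \<forall>k \<le> (\<Sum>b\<in>F. m b). \<exists>y. (\<forall>b\<in>F. U b (y b)) \<and> (\<Sum>b\<in>F. w b * y b) = a + of_nat k"
  using assms
proof (induction F rule: finite_induct)
  case empty
  then show ?case
    by (intro exI[of _ 0]) simp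
next
  case (insert b F)
  obtain a1 where a1: "\<And>k. k \<le> (\<Sum>b\<in>F. m b) \<Longrightarrow>
      \<exists>y. (\<forall>b\<in>F. U b (y b)) \<and> (\<Sum>b\<in>F. w b * y b) = a1 + of_nat k"
    using insert.IH insert.prems by blast
  obtain a2 where a2: "\<And>k. k \<le> m b \<Longrightarrow> \<exists>x. U b x \<and> w b * x = a2 + of_nat k"
    using insert.prems[of b] by blast
  have "\<exists>y. (\<forall>b\<in>insert b F. U b (y b)) \<and>
      (\<Sum>b\<in>insert b F. w b * y b) = (a1 + a2) + of_nat k"
    if k: "k \<le> (\<Sum>b\<in>insert b F. m b)" for k
  proof -
    \<comment> \<open>The new block takes as much of \<open>k\<close> as it can; the rest is within
      reach of \<open>F\<close>.\<close>
    define k2 where "k2 = min k (m b)"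
    have "k - k2 \<le> (\<Sum>b\<in>F. m b)"
      using k insert.hyps by (auto simp: k2_def)
    then obtain y where y: "\<forall>b\<in>F. U b (y b)" "(\<Sum>b\<in>F. w b * y b) = a1 + of_nat (k - k2)"
      using a1 by blast
    obtain x where x: "U b x" "w b * x = a2 + of_nat k2"
      using a2[of k2] by (auto simp: k2_def)
    have "(\<Sum>c\<in>F. w c * (y(b := x)) c) = (\<Sum>c\<in>F. w c * y c)"
      using insert.hyps by (intro sum.cong) auto
    moreover have "(of_nat (k - k2) :: 4) + of_nat k2 = of_nat k"
      unfolding of_nat_add[symmetric] by (simp add: k2_def)
    ultimately have "(\<Sum>c\<in>insert b F. w c * (y(b := x)) c) = (a1 + a2) + of_nat k"
      using insert.hyps x(2) y(2) by (simp add: algebra_simps)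
    moreover have "\<forall>c\<in>insert b F. U c ((y(b := x)) c)"
      using y(1) x(1) insert.hyps by auto
    ultimately show ?thesis
      by blast
  qed
  then show ?case
    by blast
qed

lemma sum_free_columns:
  fixes J :: "nat set"
  shows "(\<Sum>b<n. of_bool (2 * b \<notin> J) + of_bool (2 * b + 1 \<notin> J)) = card ({..<2 * n} - J)"
proof -
  have "(\<Sum>b<n. of_bool (2 * b \<notin> J) + of_bool (2 * b + 1 \<notin> J)) =
      (\<Sum>c<2 * n. of_bool (c \<notin> J) :: nat)"
    by (induction n) simp_all
  also have "\<dots> = card ({..<2 * n} \<inter> {c. c \<notin> J})"
    by simp
  also have "{..<2 * n} \<inter> {c. c \<notin> J} = {..<2 * n} - J"
    by auto
  finally show ?thesis .
qed

text \<open>\<open>t\<close> is the index of the only entry that may be 2; this entry may also be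
  odd, so both cases of the theorem are covered.\<close>

lemma has_projectivity_generated_design:
  assumes n: "n \<ge> 1" and v: "v \<in> carrier_vec n" and t: "t < n"
    and nz: "\<And>j. j < n \<Longrightarrow> v $ j \<noteq> 0"
    and odd: "\<And>j. j < n \<Longrightarrow> j \<noteq> t \<Longrightarrow> v $ j \<noteq> 2"
  shows "has_projectivity (generated_design v) (2 * n - 1)"
  unfolding has_projectivity_generated_design_iff[OF v]
proof (intro conjI allI impI ballI)
  show "2 * n - 1 \<le> 2 * n + 2"
    by simp
  fix J s
  assume J: "J \<subseteq> {..<2 * n + 2} \<and> card J = 2 * n - 1" and s: "s \<in> J \<rightarrow> {1, - 1 :: int}"
  \<comment> \<open>\<open>block_contains_progression\<close> asks for levels in both columns of a
    block, so the free ones get a dummy level 1, which \<open>U\<close> never consults.\<close>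
  define s' where "s' c = (if c \<in> J then s c else 1)" for c
  have s': "s' c \<in> {1, - 1}" for c
    using s by (auto simp: s'_def)
  define U where "U b x \<longleftrightarrow> (\<forall>c \<in> J \<inter> {2 * b, 2 * b + 1}. gray_coord c x = s' c)" for b x
  define m :: "nat \<Rightarrow> nat" where "m b = of_bool (2 * b \<notin> J) + of_bool (2 * b + 1 \<notin> J)" for b
  define w :: "nat \<Rightarrow> 4" where "w b = (case b of 0 \<Rightarrow> - 1 | Suc j \<Rightarrow> v $ j)" for b
  \<comment> \<open>Every block in \<open>?F\<close> has odd weight; block \<open>Suc t\<close> is
    kept apart because its step \<open>r\<close> may be 2.\<close>
  let ?F = "{..<Suc n} - {Suc t}"
  have "w b \<noteq> 0" if "b < Suc n" for b
    using that nz by (auto simp: w_def split: nat.split)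
  then have block: "\<exists>a. \<forall>k\<le>m b. \<exists>x. U b x \<and> w b * x = a + (if w b = 2 then 2 else 1) * of_nat k"
    if "b < Suc n" for b
    unfolding m_def U_def using that s' by (intro block_contains_progression) auto
  have "w b \<noteq> 2" if "b \<in> ?F" for b
    using that odd by (auto simp: w_def split: nat.split)
  then have "\<exists>a. \<forall>k\<le>m b. \<exists>x. U b x \<and> w b * x = a + of_nat k" if "b \<in> ?F" for b
    using that block[of b] by simp
  then obtain a1 where a1: "\<And>k. k \<le> (\<Sum>b\<in>?F. m b) \<Longrightarrow>
      \<exists>y. (\<forall>b\<in>?F. U b (y b)) \<and> (\<Sum>b\<in>?F. w b * y b) = a1 + of_nat k"
    using odd_blocks_contain_progression[of ?F m U w] by blast
  obtain a2 and r :: nat where r: "r = 1 \<or> r = 2"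
    and a2: "\<And>k. k \<le> m (Suc t) \<Longrightarrow> \<exists>x. U (Suc t) x \<and> w (Suc t) * x = a2 + of_nat (r * k)"
  proof (cases "w (Suc t) = 2")
    case True
    then show thesis
      using that[of 2] block[of "Suc t"] t by auto
  next
    case False
    then show thesis
      using that[of 1] block[of "Suc t"] t by auto
  qed
  have "card ({..<2 * Suc n} - J) = 3"
    using J n by (subst card_Diff_subset) (auto intro: finite_subset)
  then have "(\<Sum>b<Suc n. m b) = 3"
    unfolding m_def sum_free_columns .
  then have M: "(\<Sum>b\<in>?F. m b) + m (Suc t) = 3"
    using t by (subst (asm) sum.remove[of _ "Suc t"]) auto
  \<comment> \<open>The sum must move from its starting value \<open>a1 + a2\<close> to 0, a
    distance of \<open>e\<close> at most 3.\<close>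
  obtain e where e: "e < 4" "- (a1 + a2) = of_nat e"
    by (rule Z4_obtain_digit)
  \<comment> \<open>Block \<open>Suc t\<close> takes as many steps as fit into \<open>e\<close>. If
    it takes all \<open>m (Suc t)\<close> of them, at most \<open>3 - m (Suc t)\<close> remains
    since \<open>r \<ge> 1\<close>; otherwise less than \<open>r\<close>, hence at most 1, remains,
    which is small enough since \<open>m (Suc t) \<le> 2\<close>.\<close>
  obtain k1 k2 where k: "k1 \<le> (\<Sum>b\<in>?F. m b)" "k2 \<le> m (Suc t)" "e = k1 + r * k2"
  proof -
    have "m (Suc t) \<le> 2"
      by (simp add: m_def)
    moreover have "e \<le> 3"
      using e(1) by simp
    ultimately have "r * min (m (Suc t)) (e div r) \<le> e"
      "e - r * min (m (Suc t)) (e div r) \<le> 3 - m (Suc t)"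
      using r by (auto simp: min_def)
    then show thesis
      using M that[of "e - r * min (m (Suc t)) (e div r)" "min (m (Suc t)) (e div r)"] by simp
  qed
  obtain y where y: "\<forall>b\<in>?F. U b (y b)" "(\<Sum>b\<in>?F. w b * y b) = a1 + of_nat k1"
    using a1[OF k(1)] by blast
  obtain x where x: "U (Suc t) x" "w (Suc t) * x = a2 + of_nat (r * k2)"
    using a2[OF k(2)] by blast
  define z where "z = y(Suc t := x)"
  have "(\<Sum>b<Suc n. w b * z b) = w (Suc t) * z (Suc t) + (\<Sum>b\<in>?F. w b * z b)"
    using t by (subst sum.remove[of _ "Suc t"]) auto
  also have "(\<Sum>b\<in>?F. w b * z b) = (\<Sum>b\<in>?F. w b * y b)"
    by (intro sum.cong) (auto simp: z_def)
  also have "w (Suc t) * z (Suc t) + (\<Sum>b\<in>?F. w b * y b) = (a1 + a2) + of_nat e"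
    by (simp add: z_def x(2) y(2) k(3))
  also have "\<dots> = 0"
    using e(2)[symmetric] by simp
  finally have "- z 0 + (\<Sum>j<n. v $ j * z (Suc j)) = 0"
    unfolding sum.lessThan_Suc_shift by (simp add: w_def)
  then have "codeword v z"
    using v by (simp add: codeword_def add_eq_0_iff)
  moreover have "gray_coord c (z (c div 2)) = s c" if c: "c \<in> J" for c
  proof -
    have "c div 2 < Suc n"
      using c J by auto
    then have "U (c div 2) (z (c div 2))"
      using y(1) x(1) by (auto simp: z_def)
    moreover have "c \<in> {2 * (c div 2), 2 * (c div 2) + 1}"
      by (cases "even c") auto
    ultimately show ?thesis
      using c unfolding U_def s'_def by auto
  qed
  ultimately show "\<exists>y. codeword v y \<and> (\<forall>c\<in>J. gray_coord c (y (c div 2)) = s c)"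
    by blast
qed

text \<open>The index sets of the entries 1, 2 and 3 are disjoint and their sizes add up to
  \<open>n\<close>, so they leave no index for an entry 0.\<close>

lemma entries_nonzero_at_most_one_2:
  assumes v: "v \<in> carrier_vec n" and n: "n \<ge> 1"
    and total: "entry_count 1 v + entry_count 2 v + entry_count 3 v = n"
    and two: "entry_count 2 v \<le> 1"
  obtains t where "t < n" "\<And>j. j < n \<Longrightarrow> v $ j \<noteq> 0" "\<And>j. j < n \<Longrightarrow> j \<noteq> t \<Longrightarrow> v $ j \<noteq> 2"
proof -
  define E where "E a = {j. j < n \<and> v $ j = a}" for a
  have cnt: "entry_count a v = card (E a)" for a
    using v by (auto simp: entry_count_def E_def)
  have fin: "finite (E a)" for a
    by (simp add: E_def)
  have "card (E 1 \<union> E 2 \<union> E 3) = n"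
    using total fin unfolding cnt
    by (subst card_Un_disjoint; (subst card_Un_disjoint)?) (auto simp: E_def)
  then have E: "E 1 \<union> E 2 \<union> E 3 = {..<n}"
    by (intro card_subset_eq) (auto simp: E_def)
  have nz: "v $ j \<noteq> 0" if "j < n" for j
  proof -
    have "j \<in> E 1 \<union> E 2 \<union> E 3"
      using E that by simp
    then show ?thesis
      by (auto simp: E_def)
  qed
  have two': "i = j" if "i \<in> E 2" "j \<in> E 2" for i j
    using two that fin unfolding cnt by (metis card_le_Suc0_iff_eq One_nat_def)
  show thesis
  proof (cases "E 2 = {}")
    \<comment> \<open>Without an entry 2 any index serves as \<open>t\<close>; 0 is one because
      \<open>n \<ge> 1\<close>.\<close>
    case True
    then show thesis
      using n nz that[of 0] by (auto simp: E_def)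
  next
    case False
    then obtain t where "t \<in> E 2"
      by blast
    moreover from this have "v $ j \<noteq> 2" if "j < n" "j \<noteq> t" for j
      using that two'[of j t] by (auto simp: E_def)
    ultimately show thesis
      using nz that[of t] by (simp add: E_def)
  qed
qed

theorem theorem7:
  fixes n :: nat and v :: "4 vec"
  assumes "n \<ge> 1"
    and "v \<in> carrier_vec n"
    and "(entry_count 1 v + entry_count 3 v = n - 1 \<and> entry_count 2 v = 1) \<or>
         (entry_count 1 v + entry_count 3 v = n \<and> entry_count 2 v = 0)"
  shows "has_maximum_projectivity_among (generated_design v) (2 * n - 1)
           (generated_design ` carrier_vec n)"
proof -
  have upper: "projectivity (generated_design u) \<le> 2 * n - 1" if u: "u \<in> carrier_vec n" for u
  proof -
    have "0 < dim_row (generated_design u)"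
      using generated_design_carrier[OF u] by simp
    then have "projectivity (generated_design u) < 2 * n"
      using not_has_projectivity_generated_design[OF assms(1) u] by (rule projectivity_less)
    then show ?thesis
      by simp
  qed
  \<comment> \<open>Both alternatives reduce to this common form, the first one by
    \<open>n - 1 + 1 = n\<close>.\<close>
  have "entry_count 1 v + entry_count 2 v + entry_count 3 v = n" "entry_count 2 v \<le> 1"
    using assms(1,3) by auto
  then obtain t where "t < n" "\<And>j. j < n \<Longrightarrow> v $ j \<noteq> 0" "\<And>j. j < n \<Longrightarrow> j \<noteq> t \<Longrightarrow> v $ j \<noteq> 2"
    using entries_nonzero_at_most_one_2[OF assms(2,1)] by metis
  then have "2 * n - 1 \<le> projectivity (generated_design v)"
    using assms(1,2) by (intro projectivity_ge has_projectivity_generated_design)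
  then show ?thesis
    using upper assms(2) unfolding has_maximum_projectivity_among_def by (auto intro: antisym)
qed

end
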